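(* Let $M$ be a metric space with base point $0$, equipped with an isometric action of the circle group $\mathbb T$ fixing $0$. Then the space $\mathcal F_{\mathbb C}(M)$ is linearly isomorphic to the complemented subspace $Z_{\mathbb T}$ of $\mathcal F(M)$ defined as $$Z_{\mathbb T}=\overline{\mathrm{span}}\left\{\int_{\theta}\big(\cos\theta\,\delta(e^{-i\theta}.m)+\sin\theta\,\delta(ie^{-i\theta}.m)\big)\frac{d\theta}{2\pi}:\ m\in M\right\}.$$
   Context: For a metric space $M$ with base point $0$, $\mathrm{Lip}_0(M)$ is the Banach space of Lipschitz functions $f\colon M\to\mathbb R$ with $f(0)=0$, normed by the least Lipschitz constant; $\delta\colon M\to \mathrm{Lip}_0(M)^*$ is given by $\langle f,\delta(m)\rangle=f(m)$; the (real) Lipschitz-free space is the norm-closed subspace $\mathcal F(M)=\overline{\mathrm{span}}\,\delta(M)$ of $\mathrm{Lip}_0(M)^*$. $\mathbb T$ is the unit circle as a multiplicative group, and $e^{i\theta}.m$ denotes the action of $e^{i\theta}\in\mathbb T$ on $m\in M$. Given an isometric action of $\mathbb T$ on $M$ fixing $0$, put $$Y_{\mathbb T}=\overline{\mathrm{span}}\{\delta(e^{i\theta}.m)-\cos\theta\,\delta(m)-\sin\theta\,\delta(i.m):\ m\in M,\ \theta\in\mathbb R\}\subseteq\mathcal F(M),$$ and let $\mathcal F_{\mathbb C}(M)=\mathcal F(M)/Y_{\mathbb T}$ be the quotient space, which is a complex space under the law defined by $i.(\delta(m)+Y_{\mathbb T})=\delta(i.m)+Y_{\mathbb T}$. The integrals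 are Bochner integrals in $\mathcal F(M)$ over $\theta\in[0,2\pi]$. A subspace is complemented if it is the range of a bounded linear projection.
   Formalization: The action of the circle group is assumed continuous (each orbit map is continuous on the circle); without this the Bochner integrals defining Z_T need not exist, and their existence for all m is equivalent to it. *)

theory Defs
  imports "HOL-Analysis.Analysis"
begin

section \<open>Pointed metric spaces and Lipschitz functions\<close>

text \<open>The base point is the constant \<^term>\<open>0\<close>; no axiom relates it to the metric.\<close>

class pointed_metric_space = metric_space + zero

typedef (overloaded) ('m::pointed_metric_space) lip0 =
  "{f :: 'm \<Rightarrow> real. f 0 = 0 \<and> (\<exists>L. L-lipschitz_on UNIV f)}"
  morphisms lip0_apply Abs_lip0
  by (rule exI[of _ "\<lambda>_. 0"]) (auto intro!: exI[of _ 0] simp: lipschitz_on_def)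

setup_lifting type_definition_lip0

instantiation lip0 :: (pointed_metric_space) real_vector
begin

lift_definition zero_lip0 :: "'a lip0" is "\<lambda>_. 0"
  by (auto intro!: exI[of _ 0] simp: lipschitz_on_def)

lift_definition plus_lip0 :: "'a lip0 \<Rightarrow> 'a lip0 \<Rightarrow> 'a lip0" is "\<lambda>f g x. f x + g x"
  by (auto intro: lipschitz_on_add)

lift_definition uminus_lip0 :: "'a lip0 \<Rightarrow> 'a lip0" is "\<lambda>f x. - f x"
  by (auto intro: lipschitz_on_minus)

lift_definition minus_lip0 :: "'a lip0 \<Rightarrow> 'a lip0 \<Rightarrow> 'a lip0" is "\<lambda>f g x. f x - g x"
  by (auto intro: lipschitz_on_diff)

lift_definition scaleR_lip0 :: "real \<Rightarrow> 'a lip0 \<Rightarrow> 'a lip0" is "\<lambda>r f x. r * f x"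
  by (auto intro: lipschitz_on_cmult_real)

instance
  by standard (transfer; force simp: algebra_simps)+

end

definition lip_const :: "('m::metric_space \<Rightarrow> real) \<Rightarrow> real"
  where "lip_const f = Inf {L. L-lipschitz_on UNIV f}"

lemma lip_const_le: "L-lipschitz_on UNIV f \<Longrightarrow> lip_const f \<le> L"
  unfolding lip_const_def
  by (rule cInf_lower) (auto intro!: bdd_belowI[of _ 0] dest: lipschitz_on_nonneg)

text \<open>The infimum is attained, so \<^const>\<open>lip_const\<close> is the least Lipschitz constant.\<close>

lemma lipschitz_on_lip_const:
  assumes "L-lipschitz_on UNIV f"
  shows "(lip_const f)-lipschitz_on UNIV f"
proof (rule lipschitz_onI)
  let ?A = "{L. L-lipschitz_on UNIV f}"
  have ne: "?A \<noteq> {}" using assms by auto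
  show "0 \<le> lip_const f"
    unfolding lip_const_def by (rule cInf_greatest[OF ne]) (auto dest: lipschitz_on_nonneg)
  fix x y
  show "dist (f x) (f y) \<le> lip_const f * dist x y"
  proof (cases "x = y")
    case False
    have "dist (f x) (f y) / dist x y \<le> lip_const f"
      unfolding lip_const_def
      by (rule cInf_greatest[OF ne])
        (use False in \<open>auto simp: divide_le_eq dest: lipschitz_onD\<close>)
    then show ?thesis using False by (simp add: divide_le_eq)
  qed auto
qed

instantiation lip0 :: (pointed_metric_space) real_normed_vector
begin

lift_definition norm_lip0 :: "'a lip0 \<Rightarrow> real" is lip_const .

definition dist_lip0 :: "'a lip0 \<Rightarrow> 'a lip0 \<Rightarrow> real"
  where "dist_lip0 f g = norm (f - g)"

definition uniformity_lip0 :: "('a lip0 \<times> 'a lip0) filter"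
  where "uniformity_lip0 = (INF e\<in>{0 <..}. principal {(x, y). dist x y < e})"

definition open_lip0 :: "'a lip0 set \<Rightarrow> bool"
  where "open_lip0 S = (\<forall>x\<in>S. \<forall>\<^sub>F (x', y) in uniformity. x' = x \<longrightarrow> y \<in> S)"

definition sgn_lip0 :: "'a lip0 \<Rightarrow> 'a lip0"
  where "sgn_lip0 f = f /\<^sub>R norm f"

instance
proof
  fix f g :: "'a lip0" and r :: real
  have scale_le: "norm (s *\<^sub>R h) \<le> \<bar>s\<bar> * norm h" for s and h :: "'a lip0"
    by transfer (auto intro!: lip_const_le lipschitz_on_cmult_real lipschitz_on_lip_const)
  have norm_zero_lip0: "norm (0 :: 'a lip0) = 0"
  proof (rule antisym)
    show "norm (0 :: 'a lip0) \<le> 0"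
      using scale_le[of 0 0] by simp
    show "0 \<le> norm (0 :: 'a lip0)"
      by transfer (rule lipschitz_on_nonneg[OF lipschitz_on_lip_const[of 0]], simp add: lipschitz_on_def)
  qed
  show "norm f = 0 \<longleftrightarrow> f = 0"
  proof
    assume "norm f = 0"
    then show "f = 0"
    proof transfer
      fix f :: "'a \<Rightarrow> real"
      assume f: "f 0 = 0 \<and> (\<exists>L. L-lipschitz_on UNIV f)" and "lip_const f = 0"
      then have "0-lipschitz_on UNIV f" using lipschitz_on_lip_const by fastforce
      then have "dist (f x) (f 0) \<le> 0 * dist x 0" for x by (rule lipschitz_onD) auto
      then show "f = (\<lambda>_. 0)" using f by auto
    qed
  next
    assume "f = 0"
    then show "norm f = 0" using norm_zero_lip0 by simp
  qed
  show "norm (f + g) \<le> norm f + norm g"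
    by transfer (auto intro!: lip_const_le lipschitz_on_add lipschitz_on_lip_const)
  show "norm (r *\<^sub>R f) = \<bar>r\<bar> * norm f"
  proof (cases "r = 0")
    case True
    then show ?thesis using norm_zero_lip0 by simp
  next
    case False
    have "norm f \<le> \<bar>inverse r\<bar> * norm (r *\<^sub>R f)"
      using scale_le[of "inverse r" "r *\<^sub>R f"] False by simp
    then have "\<bar>r\<bar> * norm f \<le> norm (r *\<^sub>R f)"
      using False by (simp add: abs_inverse field_simps)
    then show ?thesis using scale_le[of r f] by simp
  qed
qed (auto simp: dist_lip0_def uniformity_lip0_def open_lip0_def sgn_lip0_def)

end

lemma lip0_apply_diff_le: "\<bar>lip0_apply f x - lip0_apply f y\<bar> \<le> norm f * dist x y"
proof transfer
  fix f :: "'a \<Rightarrow> real" and x y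
  assume "f 0 = 0 \<and> (\<exists>L. L-lipschitz_on UNIV f)"
  then obtain L where "L-lipschitz_on UNIV f" by blast
  from lipschitz_onD[OF lipschitz_on_lip_const[OF this], of x y]
  show "\<bar>f x - f y\<bar> \<le> lip_const f * dist x y" by (simp add: dist_real_def)
qed

lemma lip0_apply_0: "lip0_apply f 0 = 0"
  by transfer simp


section \<open>The Lipschitz-free space\<close>

lift_definition eval_lip0 :: "'m::pointed_metric_space \<Rightarrow> 'm lip0 \<Rightarrow>\<^sub>L real"
  is "\<lambda>m f. lip0_apply f m"
proof (rule bounded_linear_intro)
  fix m :: 'm and f g :: "'m lip0" and r :: real
  show "lip0_apply (f + g) m = lip0_apply f m + lip0_apply g m"
    by (simp add: plus_lip0.rep_eq)
  show "lip0_apply (r *\<^sub>R f) m = r *\<^sub>R lip0_apply f m"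
    by (simp add: scaleR_lip0.rep_eq)
  show "norm (lip0_apply f m) \<le> norm f * dist m 0"
    using lip0_apply_diff_le[of f m 0] by (simp add: lip0_apply_0)
qed

typedef (overloaded) ('m::pointed_metric_space) lipfree =
  "closure (span (range eval_lip0)) :: ('m lip0 \<Rightarrow>\<^sub>L real) set"
  morphisms dual_of_lipfree Abs_lipfree
  using closure_subset span_zero by blast

setup_lifting type_definition_lipfree

lemma subspace_closure:
  fixes S :: "'v::real_normed_vector set"
  assumes "subspace S"
  shows "subspace (closure S)"
proof (rule subspaceI)
  show "0 \<in> closure S" using closure_subset subspace_0[OF assms] by blast
  fix x y r assume "x \<in> closure S" "y \<in> closure S"
  then obtain f g where f: "\<And>n. f n \<in> S" "f \<longlonglongrightarrow> x" and g: "\<And>n. g n \<in> S" "g \<longlonglongrightarrow> y"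
    unfolding closure_sequential by blast
  have "\<And>n. f n + g n \<in> S" "(\<lambda>n. f n + g n) \<longlonglongrightarrow> x + y"
    using f g by (auto intro: subspace_add[OF assms] tendsto_add)
  then show "x + y \<in> closure S" unfolding closure_sequential by (intro exI[of _ "\<lambda>n. f n + g n"]) auto
  have "\<And>n. r *\<^sub>R f n \<in> S" "(\<lambda>n. r *\<^sub>R f n) \<longlonglongrightarrow> r *\<^sub>R x"
    using f by (auto intro: subspace_scale[OF assms] tendsto_scaleR)
  then show "r *\<^sub>R x \<in> closure S" unfolding closure_sequential by (intro exI[of _ "\<lambda>n. r *\<^sub>R f n"]) auto
qed

lemma subspace_lipfree: "subspace (closure (span (range eval_lip0)))"
  by (intro subspace_closure subspace_span)

instantiation lipfree :: (pointed_metric_space) real_vector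
begin

lift_definition zero_lipfree :: "'a lipfree" is 0
  by (rule subspace_0[OF subspace_lipfree])

lift_definition plus_lipfree :: "'a lipfree \<Rightarrow> 'a lipfree \<Rightarrow> 'a lipfree" is "(+)"
  by (rule subspace_add[OF subspace_lipfree])

lift_definition uminus_lipfree :: "'a lipfree \<Rightarrow> 'a lipfree" is uminus
  by (rule subspace_neg[OF subspace_lipfree])

lift_definition minus_lipfree :: "'a lipfree \<Rightarrow> 'a lipfree \<Rightarrow> 'a lipfree" is "(-)"
  by (rule subspace_diff[OF subspace_lipfree])

lift_definition scaleR_lipfree :: "real \<Rightarrow> 'a lipfree \<Rightarrow> 'a lipfree" is "(*\<^sub>R)"
  by (rule subspace_scale[OF subspace_lipfree])

instance
  by standard (transfer; simp add: algebra_simps)+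

end

instantiation lipfree :: (pointed_metric_space) real_normed_vector
begin

lift_definition norm_lipfree :: "'a lipfree \<Rightarrow> real" is norm .

definition dist_lipfree :: "'a lipfree \<Rightarrow> 'a lipfree \<Rightarrow> real"
  where "dist_lipfree x y = norm (x - y)"

definition uniformity_lipfree :: "('a lipfree \<times> 'a lipfree) filter"
  where "uniformity_lipfree = (INF e\<in>{0 <..}. principal {(x, y). dist x y < e})"

definition open_lipfree :: "'a lipfree set \<Rightarrow> bool"
  where "open_lipfree S = (\<forall>x\<in>S. \<forall>\<^sub>F (x', y) in uniformity. x' = x \<longrightarrow> y \<in> S)"

definition sgn_lipfree :: "'a lipfree \<Rightarrow> 'a lipfree"
  where "sgn_lipfree x = x /\<^sub>R norm x"

instance
proof
  fix x y :: "'a lipfree" and r :: real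
  show "norm x = 0 \<longleftrightarrow> x = 0" by transfer simp
  show "norm (x + y) \<le> norm x + norm y" by transfer (rule norm_triangle_ineq)
  show "norm (r *\<^sub>R x) = \<bar>r\<bar> * norm x" by transfer simp
qed (auto simp: dist_lipfree_def uniformity_lipfree_def open_lipfree_def sgn_lipfree_def)

end

instance lipfree :: (pointed_metric_space) banach
proof
  fix X :: "nat \<Rightarrow> 'a lipfree"
  assume "Cauchy X"
  let ?Y = "\<lambda>n. dual_of_lipfree (X n)"
  have dist_eq: "dist x y = dist (dual_of_lipfree x) (dual_of_lipfree y)" for x y :: "'a lipfree"
    by (simp add: dist_norm norm_lipfree.rep_eq minus_lipfree.rep_eq)
  have "Cauchy ?Y"
    using \<open>Cauchy X\<close> by (simp add: Cauchy_def dist_eq)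
  then have "convergent ?Y" by (rule Cauchy_convergent)
  then obtain l where l: "?Y \<longlonglongrightarrow> l" unfolding convergent_def ..
  have "l \<in> closure (span (range eval_lip0))"
    by (rule closed_sequentially[OF closed_closure dual_of_lipfree l])
  then have "dual_of_lipfree (Abs_lipfree l) = l" by (rule Abs_lipfree_inverse)
  then have "X \<longlonglongrightarrow> Abs_lipfree l"
    using l by (simp add: lim_sequentially dist_eq)
  then show "convergent X" by (rule convergentI)
qed

lift_definition delta :: "'m::pointed_metric_space \<Rightarrow> 'm lipfree" is eval_lip0
  by (intro subsetD[OF closure_subset] span_base rangeI)


section \<open>Bochner integral in arbitrary normed spaces\<close>

text \<open>
  This is the definition of \<^const>\<open>has_bochner_integral\<close> without its restriction to second
  countable (that is, separable) spaces, which Lipschitz-free spaces need not satisfy. Almost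
  separable-valuedness is enforced by the approximating simple functions.
\<close>

definition has_bochner :: "'a measure \<Rightarrow> ('a \<Rightarrow> 'b::real_normed_vector) \<Rightarrow> 'b \<Rightarrow> bool"
  where "has_bochner M f x \<longleftrightarrow>
    f \<in> borel_measurable M \<and>
    (\<exists>s. (\<forall>i. Bochner_Integration.simple_bochner_integrable M (s i)) \<and>
         (\<lambda>i. \<integral>\<^sup>+x. ennreal (norm (f x - s i x)) \<partial>M) \<longlonglongrightarrow> 0 \<and>
         (\<lambda>i. Bochner_Integration.simple_bochner_integral M (s i)) \<longlonglongrightarrow> x)"

definition bochner_integral :: "'a measure \<Rightarrow> ('a \<Rightarrow> 'b::real_normed_vector) \<Rightarrow> 'b"
  where "bochner_integral M f = (THE x. has_bochner M f x)"

lemma has_bochner_iff_has_bochner_integral: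
  fixes x :: "'b::{real_normed_vector, second_countable_topology}"
  shows "has_bochner M f x \<longleftrightarrow> has_bochner_integral M f x"
  unfolding has_bochner_def has_bochner_integral.simps by blast


lemma borel_measurable_norm_diff_simple:
  fixes f :: "'a \<Rightarrow> 'b::real_normed_vector"
  assumes "f \<in> borel_measurable M" and "Bochner_Integration.simple_bochner_integrable M u"
  shows "(\<lambda>x. norm (f x - u x)) \<in> borel_measurable M"
proof -
  have u: "simple_function M u" using assms(2) by (auto elim: Bochner_Integration.simple_bochner_integrable.cases)
  show ?thesis
  proof (rule measurable_compose_countable'[where f = "\<lambda>c x. norm (f x - c)" and g = u and I = "u ` space M"])
    show "(\<lambda>x. norm (f x - c)) \<in> borel_measurable M" for c
      by (rule measurable_compose[OF assms(1)])
        (intro borel_measurable_continuous_onI continuous_intros)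
    show "u \<in> M \<rightarrow>\<^sub>M count_space (u ` space M)"
      using measurable_simple_function[OF u]
      by (rule measurable_count_space_extend[rotated 2]) auto
    show "countable (u ` space M)"
      using u by (simp add: simple_function_def countable_finite)
  qed
qed

lemma simple_bochner_integral_diff_bound:
  fixes f :: "'a \<Rightarrow> 'b::real_normed_vector"
  assumes f: "f \<in> borel_measurable M"
    and s: "Bochner_Integration.simple_bochner_integrable M s"
    and t: "Bochner_Integration.simple_bochner_integrable M t"
  shows "ennreal (norm (Bochner_Integration.simple_bochner_integral M s - Bochner_Integration.simple_bochner_integral M t))
    \<le> (\<integral>\<^sup>+x. ennreal (norm (f x - s x)) \<partial>M) + (\<integral>\<^sup>+x. ennreal (norm (f x - t x)) \<partial>M)"
proof -
  have st: "Bochner_Integration.simple_bochner_integrable M (\<lambda>x. s x - t x)"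
    using s t by (rule simple_bochner_integrable_compose2[rotated]) simp
  have "norm (Bochner_Integration.simple_bochner_integral M (s) - Bochner_Integration.simple_bochner_integral M (t))
      \<le> Bochner_Integration.simple_bochner_integral M (\<lambda>x. norm (s x - t x))"
    using simple_bochner_integral_norm_bound[OF st] by (simp add: simple_bochner_integral_diff s t)
  then have "ennreal (norm (Bochner_Integration.simple_bochner_integral M (s) - Bochner_Integration.simple_bochner_integral M (t)))
      \<le> ennreal (Bochner_Integration.simple_bochner_integral M (\<lambda>x. norm (s x - t x)))"
    by (rule ennreal_leI)
  also have "\<dots> = (\<integral>\<^sup>+x. ennreal (norm (s x - t x)) \<partial>M)"
    by (rule simple_bochner_integral_eq_nn_integral)
      (auto intro: simple_bochner_integrable_compose2[where p = "\<lambda>a b. norm (a - b)"] s t)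
  also have "\<dots> \<le> (\<integral>\<^sup>+x. ennreal (norm (f x - s x)) + ennreal (norm (f x - t x)) \<partial>M)"
  proof (rule nn_integral_mono)
    fix x
    have "norm (s x - t x) \<le> norm (f x - s x) + norm (f x - t x)"
      using norm_triangle_ineq4[of "f x - t x" "f x - s x"] by simp
    then show "ennreal (norm (s x - t x)) \<le> ennreal (norm (f x - s x)) + ennreal (norm (f x - t x))"
      by (simp flip: ennreal_plus)
  qed
  also have "\<dots> = (\<integral>\<^sup>+x. ennreal (norm (f x - s x)) \<partial>M) + (\<integral>\<^sup>+x. ennreal (norm (f x - t x)) \<partial>M)"
    using borel_measurable_norm_diff_simple[OF f s] borel_measurable_norm_diff_simple[OF f t] by (intro nn_integral_add) auto
  finally show ?thesis .
qed

lemma has_bochner_unique: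
  assumes "has_bochner M f x" and "has_bochner M f y"
  shows "x = y"
proof -
  from assms(1) obtain s where f: "f \<in> borel_measurable M"
    and s: "\<And>i. Bochner_Integration.simple_bochner_integrable M (s i)"
    and s0: "(\<lambda>i. \<integral>\<^sup>+x. ennreal (norm (f x - s i x)) \<partial>M) \<longlonglongrightarrow> 0"
    and sx: "(\<lambda>i. Bochner_Integration.simple_bochner_integral M (s i)) \<longlonglongrightarrow> x"
    unfolding has_bochner_def by blast
  from assms(2) obtain t where t: "\<And>i. Bochner_Integration.simple_bochner_integrable M (t i)"
    and t0: "(\<lambda>i. \<integral>\<^sup>+x. ennreal (norm (f x - t i x)) \<partial>M) \<longlonglongrightarrow> 0"
    and ty: "(\<lambda>i. Bochner_Integration.simple_bochner_integral M (t i)) \<longlonglongrightarrow> y"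
    unfolding has_bochner_def by blast
  have "(\<lambda>i. ennreal (norm (Bochner_Integration.simple_bochner_integral M (s i) - Bochner_Integration.simple_bochner_integral M (t i))))
      \<longlonglongrightarrow> ennreal (norm (x - y))"
    by (intro tendsto_intros sx ty)
  moreover have "(\<lambda>i. (\<integral>\<^sup>+x. ennreal (norm (f x - s i x)) \<partial>M) + (\<integral>\<^sup>+x. ennreal (norm (f x - t i x)) \<partial>M))
      \<longlonglongrightarrow> 0 + 0"
    by (intro tendsto_add s0 t0)
  ultimately have "ennreal (norm (x - y)) \<le> 0 + 0"
    by (rule LIMSEQ_le) (use simple_bochner_integral_diff_bound[OF f s t] in auto)
  then show ?thesis by simp
qed

lemma bochner_integral_eq: "has_bochner M f x \<Longrightarrow> bochner_integral M f = x"
  unfolding bochner_integral_def by (blast intro: has_bochner_unique)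

lemma has_bochner_continuous:
  fixes f :: "real \<Rightarrow> 'b::banach"
  assumes f: "continuous_on {a..b} f"
  shows "\<exists>x. has_bochner (lebesgue_on {a..b}) f x"
proof -
  let ?M = "lebesgue_on {a..b}"
  let ?I = "\<lambda>s. Bochner_Integration.simple_bochner_integral ?M s"
  define p where "p n t = a + of_int \<lfloor>(t - a) * real (Suc n)\<rfloor> / real (Suc n)" for n t
  define s where "s n t = f (p n t)" for n t
  have fin: "emeasure ?M (space ?M) < \<infinity>"
    by (simp add: emeasure_restrict_space emeasure_lborel_Icc_eq)
  have meas: "f \<in> borel_measurable ?M"
    by (rule continuous_imp_measurable_on_sets_lebesgue[OF f]) simp
  have p_le: "p n t \<le> t" and p_ge: "t - 1 / real (Suc n) \<le> p n t" for n t
  proof -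
    have "of_int \<lfloor>(t - a) * real (Suc n)\<rfloor> \<le> (t - a) * real (Suc n)"
      by (rule of_int_floor_le)
    then have "of_int \<lfloor>(t - a) * real (Suc n)\<rfloor> / real (Suc n) \<le> t - a"
      by (subst pos_divide_le_eq) auto
    then show "p n t \<le> t" by (simp add: p_def)
    have "(t - a) * real (Suc n) - 1 \<le> of_int \<lfloor>(t - a) * real (Suc n)\<rfloor>"
      by linarith
    then have "((t - a) * real (Suc n) - 1) / real (Suc n) \<le> of_int \<lfloor>(t - a) * real (Suc n)\<rfloor> / real (Suc n)"
      by (rule divide_right_mono) simp
    then show "t - 1 / real (Suc n) \<le> p n t" by (simp add: p_def diff_divide_distrib)
  qed
  have p_in: "p n t \<in> {a..b}" if "t \<in> {a..b}" for n t
    using that p_le[of n t] by (auto simp: p_def)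
  have simple: "simple_function ?M (s n)" for n
  proof -
    let ?g = "\<lambda>t. \<lfloor>(t - a) * real (Suc n)\<rfloor>"
    have "?g t \<in> {0..?g b}" if "t \<in> {a..b}" for t
    proof -
      have "?g t \<le> ?g b" by (rule floor_mono, rule mult_right_mono) (use that in auto)
      then show ?thesis using that by auto
    qed
    then have "finite (?g ` space ?M)"
      by (intro finite_subset[of "?g ` space ?M" "{0..?g b}"]) auto
    moreover have "?g \<in> measurable ?M (count_space UNIV)"
    proof -
      have [measurable]: "(\<lambda>t. (t - a) * real (Suc n)) \<in> borel_measurable ?M"
        by (rule continuous_imp_measurable_on_sets_lebesgue) (auto intro!: continuous_intros)
      show ?thesis by measurable
    qed
    ultimately have "simple_function ?M ?g"
      unfolding simple_function_def by (intro conjI ballI measurable_sets) auto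
    then have "simple_function ?M ((\<lambda>k. f (a + of_int k / real (Suc n))) \<circ> ?g)"
      by (rule simple_function_compose)
    then show ?thesis by (simp add: s_def[abs_def] p_def comp_def)
  qed
  have simple_int: "Bochner_Integration.simple_bochner_integrable ?M (s n)" for n
  proof (rule Bochner_Integration.simple_bochner_integrable.intros[OF simple])
    have "emeasure ?M {y \<in> space ?M. s n y \<noteq> 0} \<le> emeasure ?M (space ?M)"
      by (rule emeasure_space)
    then show "emeasure ?M {y \<in> space ?M. s n y \<noteq> 0} \<noteq> \<infinity>" using fin by (auto simp: top_unique)
  qed
  let ?e = "\<lambda>n. \<integral>\<^sup>+t. ennreal (norm (f t - s n t)) \<partial>?M"
  have e0: "?e \<longlonglongrightarrow> 0"
  proof -
    have "bounded (f ` {a..b})"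
      using f by (intro compact_imp_bounded compact_continuous_image) auto
    then obtain B where B: "\<And>t. t \<in> {a..b} \<Longrightarrow> norm (f t) \<le> B"
      unfolding bounded_iff by blast
    have "?e \<longlonglongrightarrow> (\<integral>\<^sup>+t. 0 \<partial>?M)"
    proof (rule nn_integral_dominated_convergence[where w = "\<lambda>_. ennreal (2 * B)"])
      show "(\<lambda>t. ennreal (norm (f t - s n t))) \<in> borel_measurable ?M" for n
        using borel_measurable_norm_diff_simple[OF meas simple_int] by simp
      show "(\<integral>\<^sup>+t. ennreal (2 * B) \<partial>?M) < \<infinity>"
        using fin by (simp add: ennreal_mult_less_top)
      have "norm (f t - s n t) \<le> 2 * B" if "t \<in> {a..b}" for n t
        using norm_triangle_ineq4[of "f t" "s n t"] B[OF that] B[OF p_in[OF that, of n]]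
        by (simp add: s_def)
      then show "AE t in ?M. ennreal (norm (f t - s n t)) \<le> ennreal (2 * B)" for n
        by (intro AE_I2 ennreal_leI) auto
      have "(\<lambda>n. ennreal (norm (f t - s n t))) \<longlonglongrightarrow> 0" if t: "t \<in> {a..b}" for t
      proof -
        have "(\<lambda>n. t - 1 / real (Suc n)) \<longlonglongrightarrow> t - 0"
          by (intro tendsto_diff tendsto_const LIMSEQ_Suc[OF lim_1_over_n])
        then have lim: "(\<lambda>n. t - 1 / real (Suc n)) \<longlonglongrightarrow> t" by (simp only: diff_zero)
        have "(\<lambda>n. p n t) \<longlonglongrightarrow> t"
          by (rule tendsto_sandwich[OF always_eventually always_eventually lim tendsto_const])
            (intro allI p_ge p_le)+
        then have "(\<lambda>n. s n t) \<longlonglongrightarrow> f t"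
          unfolding s_def
          by (rule continuous_on_tendsto_compose[OF f _ t]) (intro always_eventually allI p_in[OF t])
        then have "(\<lambda>n. norm (f t - s n t)) \<longlonglongrightarrow> norm (f t - f t)"
          by (intro tendsto_intros)
        from tendsto_ennrealI[OF this] show ?thesis by simp
      qed
      then show "AE t in ?M. (\<lambda>n. ennreal (norm (f t - s n t))) \<longlonglongrightarrow> 0"
        by (intro AE_I2) auto
    qed auto
    then show ?thesis by simp
  qed
  have "Cauchy (\<lambda>n. ?I (s n))"
  proof (rule metric_CauchyI)
    fix r :: real assume r: "0 < r"
    have "eventually (\<lambda>n. ?e n < ennreal (r / 3)) sequentially"
      using e0 r by (intro order_tendstoD(2)) auto
    then obtain N where N: "\<And>n. n \<ge> N \<Longrightarrow> ?e n < ennreal (r / 3)"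
      by (auto simp: eventually_sequentially)
    have "dist (?I (s m)) (?I (s n)) < r" if "m \<ge> N" "n \<ge> N" for m n
    proof -
      have "ennreal (norm (?I (s m) - ?I (s n))) \<le> ?e m + ?e n"
        by (rule simple_bochner_integral_diff_bound[OF meas simple_int simple_int])
      also have "\<dots> \<le> ennreal (r / 3) + ennreal (r / 3)"
        by (intro add_mono less_imp_le N that)
      also have "\<dots> = ennreal (r / 3 + r / 3)" by (rule ennreal_plus[symmetric]) (use r in simp_all)
      finally have "norm (?I (s m) - ?I (s n)) \<le> r / 3 + r / 3"
        by (subst (asm) ennreal_le_iff) (use r in simp_all)
      then show ?thesis using r by (simp add: dist_norm)
    qed
    then show "\<exists>N. \<forall>m\<ge>N. \<forall>n\<ge>N. dist (?I (s m)) (?I (s n)) < r" by blast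
  qed
  then obtain x where "(\<lambda>n. ?I (s n)) \<longlonglongrightarrow> x" by (auto simp: Cauchy_convergent_iff convergent_def)
  then have "has_bochner ?M f x"
    unfolding has_bochner_def by (intro conjI exI[of _ s] allI meas simple_int e0)
  then show ?thesis ..
qed


section \<open>Circle actions\<close>

text \<open>
  \<open>act t m\<close> is meaningful for \<open>t\<close> on the unit circle only. Continuity of the orbit maps is part of
  being an action of the (topological) circle group; for isometric actions it is equivalent to
  joint continuity. It makes the integrands below continuous in \<open>\<theta>\<close>.
\<close>

locale isometric_circle_action =
  fixes act :: "complex \<Rightarrow> 'm::pointed_metric_space \<Rightarrow> 'm"
  assumes act_one: "act 1 m = m"
    and act_mult: "s \<in> sphere 0 1 \<Longrightarrow> t \<in> sphere 0 1 \<Longrightarrow> act (s * t) m = act s (act t m)"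
    and act_isometry: "t \<in> sphere 0 1 \<Longrightarrow> dist (act t m) (act t n) = dist m n"
    and act_zero: "t \<in> sphere 0 1 \<Longrightarrow> act t 0 = 0"
    and act_continuous: "continuous_on (sphere 0 1) (\<lambda>t. act t m)"

lemma norm_delta_diff_le: "norm (delta m - delta n) \<le> dist m n"
proof -
  have "norm (eval_lip0 m - eval_lip0 n) \<le> dist m n"
  proof (rule norm_blinfun_bound)
    show "norm (blinfun_apply (eval_lip0 m - eval_lip0 n) f) \<le> dist m n * norm f" for f
    proof -
      have "norm (blinfun_apply (eval_lip0 m - eval_lip0 n) f) = \<bar>lip0_apply f m - lip0_apply f n\<bar>"
        unfolding minus_blinfun.rep_eq eval_lip0.rep_eq real_norm_def ..
      also have "\<dots> \<le> norm f * dist m n" by (rule lip0_apply_diff_le)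
      finally show ?thesis by (subst mult.commute)
    qed
  qed (rule zero_le_dist)
  then show ?thesis unfolding norm_lipfree.rep_eq minus_lipfree.rep_eq delta.rep_eq .
qed

lemma (in isometric_circle_action) has_bochner_averaging_integrand:
  "has_bochner (lebesgue_on {0..2 * pi})
    (\<lambda>\<theta>. cos \<theta> *\<^sub>R delta (act (cis (- \<theta>)) m) + sin \<theta> *\<^sub>R delta (act (\<i> * cis (- \<theta>)) m))
    (bochner_integral (lebesgue_on {0..2 * pi})
      (\<lambda>\<theta>. cos \<theta> *\<^sub>R delta (act (cis (- \<theta>)) m) + sin \<theta> *\<^sub>R delta (act (\<i> * cis (- \<theta>)) m)))"
proof -
  have delta: "continuous_on S (delta :: 'm \<Rightarrow> _)" for S
  proof (rule lipschitz_on_continuous_on[where L = 1], rule lipschitz_onI)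
    show "dist (delta x) (delta y) \<le> 1 * dist x y" for x y :: 'm
      unfolding dist_norm[of "delta x"] mult_1 by (rule norm_delta_diff_le)
  qed (rule zero_le_one)
  have "continuous_on S (\<lambda>\<theta>. delta (act (h \<theta>) m))"
    if "continuous_on S h" "\<And>\<theta>. h \<theta> \<in> sphere 0 1" for h and S :: "real set"
  proof (rule continuous_on_compose2[OF delta[of UNIV]])
    show "continuous_on S (\<lambda>\<theta>. act (h \<theta>) m)"
      by (rule continuous_on_compose2[OF act_continuous that(1)]) (use that(2) in blast)
  qed simp
  note orbit = this
  have cis: "continuous_on S (\<lambda>\<theta>. cis (- \<theta>))" for S
    unfolding cis_conv_exp by (intro continuous_intros)
  have "continuous_on {0..2 * pi}
    (\<lambda>\<theta>. cos \<theta> *\<^sub>R delta (act (cis (- \<theta>)) m) + sin \<theta> *\<^sub>R delta (act (\<i> * cis (- \<theta>)) m))"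
    by (intro continuous_on_add continuous_on_scaleR continuous_on_sin continuous_on_cos
        continuous_on_id orbit continuous_on_mult continuous_on_const cis) (simp_all add: norm_mult)
  from has_bochner_continuous[OF this] obtain x where x: "has_bochner (lebesgue_on {0..2 * pi})
    (\<lambda>\<theta>. cos \<theta> *\<^sub>R delta (act (cis (- \<theta>)) m) + sin \<theta> *\<^sub>R delta (act (\<i> * cis (- \<theta>)) m)) x" ..
  then show ?thesis by (simp only: bochner_integral_eq[OF x])
qed

definition Y_circle :: "(complex \<Rightarrow> 'm::pointed_metric_space \<Rightarrow> 'm) \<Rightarrow> 'm lipfree set"
  where "Y_circle act = closure (span
    {delta (act (cis \<theta>) m) - cos \<theta> *\<^sub>R delta m - sin \<theta> *\<^sub>R delta (act \<i> m) | m \<theta>. True})"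

definition Z_circle :: "(complex \<Rightarrow> 'm::pointed_metric_space \<Rightarrow> 'm) \<Rightarrow> 'm lipfree set"
  where "Z_circle act = closure (span (range (\<lambda>m.
    (1 / (2 * pi)) *\<^sub>R bochner_integral (lebesgue_on {0..2 * pi})
      (\<lambda>\<theta>. cos \<theta> *\<^sub>R delta (act (cis (- \<theta>)) m) + sin \<theta> *\<^sub>R delta (act (\<i> * cis (- \<theta>)) m)))))"


section \<open>Quotient spaces, complemented subspaces, isomorphisms\<close>

text \<open>
  The elements of the quotient by a closed subspace \<open>Y\<close> are the cosets of \<open>Y\<close>; adding \<open>Y\<close> in
  \<open>coset_scaleR\<close> only matters for the scalar \<open>0\<close>.
\<close>

definition quotient_space :: "'v::real_normed_vector set \<Rightarrow> 'v set set"
  where "quotient_space Y = range (\<lambda>x. (+) x ` Y)"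

definition coset_add :: "'v::real_normed_vector set \<Rightarrow> 'v set \<Rightarrow> 'v set"
  where "coset_add A B = {a + b | a b. a \<in> A \<and> b \<in> B}"

definition coset_scaleR :: "'v::real_normed_vector set \<Rightarrow> real \<Rightarrow> 'v set \<Rightarrow> 'v set"
  where "coset_scaleR Y r A = {r *\<^sub>R a + y | a y. a \<in> A \<and> y \<in> Y}"

definition coset_norm :: "'v::real_normed_vector set \<Rightarrow> real"
  where "coset_norm A = (INF a\<in>A. norm a)"

definition quotient_isomorphic_to :: "'v::real_normed_vector set \<Rightarrow> 'w::real_normed_vector set \<Rightarrow> bool"
  where "quotient_isomorphic_to Y Z \<longleftrightarrow> (\<exists>\<Phi>.
    bij_betw \<Phi> (quotient_space Y) Z \<and>
    (\<forall>A\<in>quotient_space Y. \<forall>B\<in>quotient_space Y. \<Phi> (coset_add A B) = \<Phi> A + \<Phi> B) \<and>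
    (\<forall>r. \<forall>A\<in>quotient_space Y. \<Phi> (coset_scaleR Y r A) = r *\<^sub>R \<Phi> A) \<and>
    (\<exists>C. \<forall>A\<in>quotient_space Y. norm (\<Phi> A) \<le> C * coset_norm A) \<and>
    (\<exists>C. \<forall>A\<in>quotient_space Y. coset_norm A \<le> C * norm (\<Phi> A)))"

definition complemented :: "'v::real_normed_vector set \<Rightarrow> bool"
  where "complemented Z \<longleftrightarrow> (\<exists>P. bounded_linear P \<and> P \<circ> P = P \<and> range P = Z)"

end

theory Submission
  imports Defs
begin

text \<open>
  Write \<open>u \<theta> = \<delta>(e\<^sup>i\<^sup>\<theta>.m)\<close> and let \<open>G m\<close> be the average generating \<open>Z\<close>. The map \<open>G\<close> is Lipschitz and
  vanishes at \<open>0\<close>, so it extends to a bounded operator \<open>P\<close> of the free space. Shifting the variable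
  of integration shows \<open>G (e\<^sup>i\<^sup>\<phi>.m) = cos \<phi> G m + sin \<phi> G (i.m)\<close>, so \<open>P\<close> vanishes on \<open>Y\<close>. Conversely,
  modulo \<open>Y\<close> the integrand is constantly \<open>(cos\<^sup>2 \<theta> + sin\<^sup>2 \<theta>) \<delta> m\<close>, so \<open>P x - x\<close> lies in \<open>Y\<close> for every
  \<open>x\<close>. Hence \<open>P\<close> is a projection onto \<open>Z\<close> with kernel \<open>Y\<close>.
\<close>

section \<open>Projections and quotients\<close>

lemma coset_eq_iff:
  fixes Y :: "'v::real_normed_vector set"
  assumes "subspace Y"
  shows "(+) x ` Y = (+) y ` Y \<longleftrightarrow> x - y \<in> Y"
proof
  assume "(+) x ` Y = (+) y ` Y"
  moreover have "x \<in> (+) x ` Y" using subspace_0[OF assms] by force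
  ultimately obtain z where "z \<in> Y" "x = y + z" by auto
  then show "x - y \<in> Y" by simp
next
  assume *: "x - y \<in> Y"
  have "(+) a ` Y \<subseteq> (+) b ` Y" if "a - b \<in> Y" for a b
  proof
    fix z assume "z \<in> (+) a ` Y"
    then obtain w where w: "w \<in> Y" "z = a + w" by auto
    then have "z = b + (a - b + w)" "a - b + w \<in> Y" using subspace_add[OF assms that] by auto
    then show "z \<in> (+) b ` Y" by blast
  qed
  from this[of x y] this[of y x] show "(+) x ` Y = (+) y ` Y"
    using * subspace_neg[OF assms *] by auto
qed

text \<open>The two conditions on \<open>Y\<close> say that \<open>P\<close> is idempotent with
  kernel \<open>Y\<close>: \<open>P\<close> kills \<open>P x - x\<close>, so
  \<open>P (P x) = P x\<close>, and if \<open>P x = 0\<close> then \<open>- x = P x - x\<close> lies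
  in \<open>Y\<close>. Each coset therefore contains exactly one point of \<open>range P\<close>,
  and the isomorphism sends the coset to it.\<close>

lemma complemented_quotient_isomorphic:
  fixes P :: "'v::real_normed_vector \<Rightarrow> 'v"
  assumes P: "bounded_linear P"
    and Y: "subspace Y"
    and P_Y: "\<And>y. y \<in> Y \<Longrightarrow> P y = 0"
    and P_mod_Y: "\<And>x. P x - x \<in> Y"
  shows "complemented (range P) \<and> quotient_isomorphic_to Y (range P)"
proof
  interpret bounded_linear P by fact
  have PP: "P (P x) = P x" for x
    using P_Y[OF P_mod_Y[of x]] by (simp add: diff)
  then show "complemented (range P)"
    unfolding complemented_def using P by (intro exI[of _ P]) (auto simp: fun_eq_iff)
  \<comment> \<open>The choice of representative is immaterial, because \<open>P\<close> is constant
    on each coset of \<open>Y\<close>.\<close>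
  define \<Phi> where "\<Phi> A = P (SOME a. a \<in> A)" for A
  have P_coset: "P a = P x" if "a \<in> (+) x ` Y" for a x
    using that P_Y by (auto simp: add)
  have self: "x \<in> (+) x ` Y" for x
    using subspace_0[OF Y] by force
  have \<Phi>: "\<Phi> ((+) x ` Y) = P x" for x
    unfolding \<Phi>_def by (rule P_coset, rule someI[of _ x], rule self)
  obtain K where K: "0 < K" "\<And>x. norm (P x) \<le> norm x * K"
    using pos_bounded by blast
  have P_in: "P x \<in> (+) x ` Y" for x
    using P_mod_Y[of x] by force
  show "quotient_isomorphic_to Y (range P)"
    unfolding quotient_isomorphic_to_def
  proof (intro exI[of _ \<Phi>] conjI ballI allI)
    show "bij_betw \<Phi> (quotient_space Y) (range P)"
    proof (rule bij_betwI')
      fix A B assume "A \<in> quotient_space Y" "B \<in> quotient_space Y"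
      then obtain x y where AB: "A = (+) x ` Y" "B = (+) y ` Y"
        unfolding quotient_space_def by auto
      \<comment> \<open>Here \<open>x - y = (P y - y) - (P x - x)\<close>.\<close>
      have "x - y \<in> Y" if "P x = P y"
        using subspace_diff[OF Y P_mod_Y[of y] P_mod_Y[of x]] that by simp
      moreover have "P x = P y" if "x - y \<in> Y"
        using P_Y[OF that] by (simp add: diff)
      ultimately show "\<Phi> A = \<Phi> B \<longleftrightarrow> A = B"
        unfolding AB \<Phi> coset_eq_iff[OF Y] by blast
    qed (auto simp: quotient_space_def \<Phi>)
  next
    fix A B assume "A \<in> quotient_space Y" "B \<in> quotient_space Y"
    then obtain x y where AB: "A = (+) x ` Y" "B = (+) y ` Y"
      unfolding quotient_space_def by auto
    have "coset_add A B = (+) (x + y) ` Y"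
    proof (intro equalityI subsetI)
      fix z assume "z \<in> coset_add A B"
      then obtain u v where uv: "u \<in> Y" "v \<in> Y" "z = x + u + (y + v)"
        unfolding coset_add_def AB by auto
      then have "z = (x + y) + (u + v)" by simp
      then show "z \<in> (+) (x + y) ` Y" using subspace_add[OF Y uv(1,2)] by blast
    next
      fix z assume "z \<in> (+) (x + y) ` Y"
      then obtain u where "u \<in> Y" "z = x + (y + u)" by (auto simp: add.assoc)
      then show "z \<in> coset_add A B" unfolding coset_add_def AB using self by blast
    qed
    then show "\<Phi> (coset_add A B) = \<Phi> A + \<Phi> B" by (simp add: AB \<Phi> add)
  next
    fix r A assume "A \<in> quotient_space Y"
    then obtain x where A: "A = (+) x ` Y"
      unfolding quotient_space_def by auto
    have "coset_scaleR Y r A = (+) (r *\<^sub>R x) ` Y"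
    proof (intro equalityI subsetI)
      fix z assume "z \<in> coset_scaleR Y r A"
      then obtain u v where uv: "u \<in> Y" "v \<in> Y" "z = r *\<^sub>R (x + u) + v"
        unfolding coset_scaleR_def A by auto
      then have "z = r *\<^sub>R x + (r *\<^sub>R u + v)" by (simp add: algebra_simps)
      then show "z \<in> (+) (r *\<^sub>R x) ` Y"
        using subspace_add[OF Y subspace_scale[OF Y uv(1)] uv(2)] by blast
    next
      fix z assume "z \<in> (+) (r *\<^sub>R x) ` Y"
      then show "z \<in> coset_scaleR Y r A" unfolding coset_scaleR_def A using self by blast
    qed
    then show "\<Phi> (coset_scaleR Y r A) = r *\<^sub>R \<Phi> A" by (simp add: A \<Phi> scaleR)
  next
    show "\<exists>C. \<forall>A\<in>quotient_space Y. norm (\<Phi> A) \<le> C * coset_norm A"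
    proof (intro exI[of _ K] ballI)
      fix A assume "A \<in> quotient_space Y"
      then obtain x where A: "A = (+) x ` Y"
        unfolding quotient_space_def by auto
      \<comment> \<open>Every representative \<open>a\<close> satisfies \<open>P a = P x\<close>, so
        the operator bound \<open>K\<close> limits from below the norms over which the infimum is
        taken.\<close>
      have "norm (P x) / K \<le> coset_norm A"
        unfolding coset_norm_def
      proof (rule cINF_greatest)
        show "A \<noteq> {}" using self A by blast
        show "norm (P x) / K \<le> norm a" if "a \<in> A" for a
          using K(2)[of a] K(1) P_coset[OF that[unfolded A]] by (simp add: divide_le_eq)
      qed
      then show "norm (\<Phi> A) \<le> K * coset_norm A"
        using K(1) by (simp add: A \<Phi> divide_le_eq mult.commute)
    qed
    show "\<exists>C. \<forall>A\<in>quotient_space Y. coset_norm A \<le> C * norm (\<Phi> A)"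
    proof (intro exI[of _ 1] ballI)
      fix A assume "A \<in> quotient_space Y"
      then obtain x where A: "A = (+) x ` Y"
        unfolding quotient_space_def by auto
      \<comment> \<open>The point \<open>P x\<close> is itself a representative of the coset, so the
        inverse map is bounded with constant 1.\<close>
      have "coset_norm A \<le> norm (P x)"
        unfolding coset_norm_def A
        by (rule cINF_lower[OF _ P_in]) (auto intro: bdd_belowI[of _ 0])
      then show "coset_norm A \<le> 1 * norm (\<Phi> A)" by (simp add: A \<Phi>)
    qed
  qed
qed

section \<open>Lipschitz-free spaces\<close>

lemma blinfun_apply_delta: "blinfun_apply (dual_of_lipfree (delta m)) f = lip0_apply f m"
  by (simp add: delta.rep_eq eval_lip0.rep_eq)

lemma bounded_linear_dual_of_lipfree: "bounded_linear dual_of_lipfree"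
  by (rule bounded_linear_intro[where K = 1])
    (simp_all add: plus_lipfree.rep_eq scaleR_lipfree.rep_eq norm_lipfree.rep_eq)

lemma bounded_linear_lipfree_apply: "bounded_linear (\<lambda>x. blinfun_apply (dual_of_lipfree x) f)"
  by (rule bounded_linear_compose[OF blinfun.bounded_linear_left bounded_linear_dual_of_lipfree])

lemma lipfree_eqI:
  assumes "\<And>f. blinfun_apply (dual_of_lipfree x) f = blinfun_apply (dual_of_lipfree y) f"
  shows "x = y"
  using assms by (simp add: dual_of_lipfree_inject[symmetric] blinfun_eqI)

lemma delta_0: "delta 0 = 0"
  by (rule lipfree_eqI) (simp add: blinfun_apply_delta lip0_apply_0 zero_lipfree.rep_eq)

lemma lipschitz_on_delta: "1-lipschitz_on S delta"
proof (rule lipschitz_onI)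
  show "dist (delta x) (delta y) \<le> 1 * dist x y" for x y :: 'a
    unfolding dist_norm[of "delta x"] mult_1 by (rule norm_delta_diff_le)
qed simp

text \<open>\<open>dual_of_lipfree\<close> is a linear isometry carrying \<open>delta\<close> to
  \<open>eval_lip0\<close>, so the density built into the type pulls back from the dual
  space.\<close>

lemma closure_span_delta: "closure (span (range delta)) = UNIV"
proof -
  have "x \<in> closure (span (range delta))" for x :: "'a lipfree"
    unfolding closure_approachable
  proof safe
    fix e :: real assume "0 < e"
    moreover have "dual_of_lipfree x \<in> closure (span (range eval_lip0))"
      by (rule dual_of_lipfree)
    ultimately obtain z where z: "z \<in> span (range eval_lip0)" "dist z (dual_of_lipfree x) < e"
      unfolding closure_approachable by blast
    have "range eval_lip0 = dual_of_lipfree ` range (delta :: 'a \<Rightarrow> _)"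
      by (auto simp: delta.rep_eq image_image)
    then have "span (range eval_lip0) = dual_of_lipfree ` span (range (delta :: 'a \<Rightarrow> _))"
      using linear_span_image[OF bounded_linear.linear[OF bounded_linear_dual_of_lipfree]] by metis
    with z obtain y where y: "y \<in> span (range delta)" "z = dual_of_lipfree y" by auto
    moreover have "dist y x < e"
      using z(2) y(2) by (simp add: dist_norm norm_lipfree.rep_eq minus_lipfree.rep_eq)
    ultimately show "\<exists>y\<in>span (range delta). dist y x < e" by blast
  qed
  then show ?thesis by blast
qed

text \<open>An induction principle by density: a closed linear condition on the free space need only
  be checked at the points \<open>delta m\<close>.\<close>

lemma closed_subspace_lipfree_eq_UNIV:
  assumes "closed S" "subspace S" "\<And>m. delta m \<in> S"
  shows "S = UNIV"
proof -
  have "span (range delta) \<subseteq> S" by (rule span_minimal) (use assms in auto)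
  then have "closure (span (range delta)) \<subseteq> S" using assms(1) by (rule closure_minimal)
  then show ?thesis unfolding closure_span_delta by blast
qed

text \<open>
  The extension is the restriction to the free space of the adjoint of the operator
  \<open>f \<mapsto> (m \<mapsto> \<langle>f, g m\<rangle>)\<close> on Lipschitz functions.
\<close>

lemma lipfree_extension:
  fixes g :: "'m::pointed_metric_space \<Rightarrow> 'n::pointed_metric_space lipfree"
  assumes g: "L-lipschitz_on UNIV g" and g0: "g 0 = 0"
  obtains P where "bounded_linear P" "\<And>m. P (delta m) = g m"
proof -
  have L: "0 \<le> L" using g by (rule lipschitz_on_nonneg)
  \<comment> \<open>The function inside \<open>Abs_lip0\<close> is an element of
    \<open>lip0\<close>: it vanishes at the base point by \<open>g0\<close>, and \<open>lip\<close>
    below gives it the Lipschitz constant \<open>L * norm f\<close>.\<close>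
  define A where "A f = Abs_lip0 (\<lambda>m. blinfun_apply (dual_of_lipfree (g m)) f)" for f
  have lip: "(L * norm f)-lipschitz_on UNIV (\<lambda>m. blinfun_apply (dual_of_lipfree (g m)) f)" for f
  proof (rule lipschitz_onI)
    show "0 \<le> L * norm f" using L by simp
    fix m n
    have "dist (blinfun_apply (dual_of_lipfree (g m)) f) (blinfun_apply (dual_of_lipfree (g n)) f)
      = norm (blinfun_apply (dual_of_lipfree (g m - g n)) f)"
      by (simp add: dist_norm minus_lipfree.rep_eq blinfun.diff_left)
    also have "\<dots> \<le> norm (g m - g n) * norm f"
      unfolding norm_lipfree.rep_eq by (rule norm_blinfun)
    also have "\<dots> \<le> (L * dist m n) * norm f"
      using lipschitz_onD[OF g, of m n] by (intro mult_right_mono) (simp_all add: dist_norm)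
    finally show "dist (blinfun_apply (dual_of_lipfree (g m)) f)
        (blinfun_apply (dual_of_lipfree (g n)) f) \<le> L * norm f * dist m n"
      by (simp add: mult_ac)
  qed
  have A_apply: "lip0_apply (A f) m = blinfun_apply (dual_of_lipfree (g m)) f" for f m
  proof -
    have "(\<lambda>m. blinfun_apply (dual_of_lipfree (g m)) f) \<in> {f. f 0 = 0 \<and> (\<exists>L. L-lipschitz_on UNIV f)}"
      using lip by (auto simp: g0 zero_lipfree.rep_eq)
    then show ?thesis unfolding A_def by (simp add: Abs_lip0_inverse)
  qed
  have A: "bounded_linear A"
  proof (rule bounded_linear_intro)
    show "A (f + h) = A f + A h" for f h
      by (simp add: lip0_apply_inject[symmetric] fun_eq_iff A_apply plus_lip0.rep_eq blinfun.add_right)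
    show "A (r *\<^sub>R f) = r *\<^sub>R A f" for r f
      by (simp add: lip0_apply_inject[symmetric] fun_eq_iff A_apply scaleR_lip0.rep_eq blinfun.scaleR_right)
    show "norm (A f) \<le> norm f * L" for f
      using lip_const_le[OF lip[of f]]
      by (simp add: norm_lip0.rep_eq A_apply[abs_def] mult.commute)
  qed
  \<comment> \<open>The adjoint of \<open>A\<close>, defined on the whole dual of the Lipschitz
    functions.\<close>
  define T where "T x = x o\<^sub>L Blinfun A" for x :: "'m lip0 \<Rightarrow>\<^sub>L real"
  have T_apply: "blinfun_apply (T x) f = blinfun_apply x (A f)" for x f
    by (simp add: T_def bounded_linear_Blinfun_apply[OF A])
  have T: "bounded_linear T"
    unfolding T_def by (rule bounded_linear_intros)+
  have T_eval: "T (eval_lip0 m) = dual_of_lipfree (g m)" for m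
    by (rule blinfun_eqI) (simp add: T_apply eval_lip0.rep_eq A_apply)
  define P where "P x = Abs_lipfree (T (dual_of_lipfree x))" for x
  \<comment> \<open>The adjoint could leave the free space. That it does not is a closed linear
    condition, and at \<open>delta m\<close> it holds because \<open>T\<close> returns the image of
    \<open>g m\<close>.\<close>
  have in_free: "T (dual_of_lipfree x) \<in> closure (span (range eval_lip0))" for x
  proof -
    let ?C = "closure (span (range eval_lip0)) :: ('n lip0 \<Rightarrow>\<^sub>L real) set"
    have lin: "bounded_linear (\<lambda>x. T (dual_of_lipfree x))"
      by (rule bounded_linear_compose[OF T bounded_linear_dual_of_lipfree])
    have "{x. T (dual_of_lipfree x) \<in> ?C} = UNIV"
    proof (rule closed_subspace_lipfree_eq_UNIV)
      show "closed {x. T (dual_of_lipfree x) \<in> ?C}"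
        using continuous_closed_vimage[OF closed_closure, of "\<lambda>x. T (dual_of_lipfree x)"]
        by (simp add: vimage_def linear_continuous_at[OF lin])
      show "subspace {x. T (dual_of_lipfree x) \<in> ?C}"
        using linear_subspace_vimage[OF bounded_linear.linear[OF lin] subspace_lipfree]
        by (simp add: vimage_def)
      show "delta m \<in> {x. T (dual_of_lipfree x) \<in> ?C}" for m
        by (simp add: delta.rep_eq T_eval dual_of_lipfree)
    qed
    then show ?thesis by blast
  qed
  have P_dual: "dual_of_lipfree (P x) = T (dual_of_lipfree x)" for x
    unfolding P_def by (rule Abs_lipfree_inverse[OF in_free])
  interpret T: bounded_linear T by fact
  obtain K where K: "\<And>x. norm (T x) \<le> norm x * K" using T.bounded by blast
  show thesis
  proof
    show "bounded_linear P"
    proof (rule bounded_linear_intro)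
      show "P (x + y) = P x + P y" for x y
        by (simp add: dual_of_lipfree_inject[symmetric] P_dual plus_lipfree.rep_eq T.add)
      show "P (r *\<^sub>R x) = r *\<^sub>R P x" for r x
        by (simp add: dual_of_lipfree_inject[symmetric] P_dual scaleR_lipfree.rep_eq T.scaleR)
      show "norm (P x) \<le> norm x * K" for x
        by (simp add: norm_lipfree.rep_eq P_dual K)
    qed
    show "P (delta m) = g m" for m
      by (simp add: dual_of_lipfree_inject[symmetric] P_dual delta.rep_eq T_eval)
  qed
qed

section \<open>Integrals\<close>

text \<open>\<open>T\<close> sends approximating simple functions to simple functions, commutes with
  their integrals, and enlarges the approximation error by at most the factor
  \<open>K\<close>.\<close>

lemma has_bochner_bounded_linear:
  fixes T :: "'b::real_normed_vector \<Rightarrow> 'c::real_normed_vector"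
  assumes "bounded_linear T" and "has_bochner M f x"
  shows "has_bochner M (\<lambda>t. T (f t)) (T x)"
proof -
  interpret T: bounded_linear T by fact
  from assms(2) obtain s where f: "f \<in> borel_measurable M"
    and s: "\<And>i. Bochner_Integration.simple_bochner_integrable M (s i)"
    and s0: "(\<lambda>i. \<integral>\<^sup>+t. ennreal (norm (f t - s i t)) \<partial>M) \<longlonglongrightarrow> 0"
    and sx: "(\<lambda>i. Bochner_Integration.simple_bochner_integral M (s i)) \<longlonglongrightarrow> x"
    unfolding has_bochner_def by blast
  obtain K where K: "K > 0" "\<And>t i. norm (T (f t) - T (s i t)) \<le> norm (f t - s i t) * K"
    using T.pos_bounded by (auto simp: T.diff[symmetric])
  show ?thesis
    unfolding has_bochner_def
  proof (intro conjI exI[of _ "\<lambda>i t. T (s i t)"] allI)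
    show "(\<lambda>t. T (f t)) \<in> borel_measurable M"
      by (rule measurable_compose[OF f])
        (intro borel_measurable_continuous_onI T.continuous_on continuous_on_id)
    show "Bochner_Integration.simple_bochner_integrable M (\<lambda>t. T (s i t))" for i
      by (rule simple_bochner_integrable_compose2[OF _ s s, of "\<lambda>x y. T x"]) (rule T.zero)
    show "(\<lambda>i. Bochner_Integration.simple_bochner_integral M (\<lambda>t. T (s i t))) \<longlonglongrightarrow> T x"
      using T.tendsto[OF sx] by (simp add: simple_bochner_integral_linear[OF T.linear_axioms s])
    show "(\<lambda>i. \<integral>\<^sup>+t. ennreal (norm (T (f t) - T (s i t))) \<partial>M) \<longlonglongrightarrow> 0" (is "?f \<longlonglongrightarrow> 0")
    proof (rule tendsto_sandwich)
      show "eventually (\<lambda>i. 0 \<le> ?f i) sequentially" "(\<lambda>_. 0) \<longlonglongrightarrow> (0::ennreal)"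
        by auto
      let ?g = "\<lambda>i. ennreal K * (\<integral>\<^sup>+t. ennreal (norm (f t - s i t)) \<partial>M)"
      show "eventually (\<lambda>i. ?f i \<le> ?g i) sequentially"
      proof (intro always_eventually allI)
        fix i
        have "?f i \<le> (\<integral>\<^sup>+t. ennreal K * ennreal (norm (f t - s i t)) \<partial>M)"
          using K by (intro nn_integral_mono) (auto simp: ac_simps ennreal_mult[symmetric])
        also have "\<dots> = ?g i"
          using borel_measurable_norm_diff_simple[OF f s] by (intro nn_integral_cmult) auto
        finally show "?f i \<le> ?g i" .
      qed
      show "?g \<longlonglongrightarrow> 0" using ennreal_tendsto_cmult[OF _ s0, of K] by simp
    qed
  qed
qed

text \<open>Lipschitz functions separate the points of the free space, and pairing with one of them
  turns both sides into integrals of the same real function, for which the two notions agree. From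
  here on the calculus of the gauge integral is available.\<close>

lemma bochner_integral_eq_integral:
  fixes f :: "real \<Rightarrow> 'm::pointed_metric_space lipfree"
  assumes f: "continuous_on {a..b} f"
  shows "bochner_integral (lebesgue_on {a..b}) f = integral {a..b} f"
proof -
  obtain x where x: "has_bochner (lebesgue_on {a..b}) f x"
    using has_bochner_continuous[OF f] by blast
  have "x = integral {a..b} f"
  proof (rule lipfree_eqI)
    fix \<phi> :: "'m lip0"
    let ?T = "\<lambda>x. blinfun_apply (dual_of_lipfree x) \<phi>"
    have "has_bochner_integral (lebesgue_on {a..b}) (\<lambda>t. ?T (f t)) (?T x)"
      using has_bochner_bounded_linear[OF bounded_linear_lipfree_apply x]
      unfolding has_bochner_iff_has_bochner_integral .
    then have "((\<lambda>t. ?T (f t)) has_integral ?T x) {a..b}"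
      using has_integral_integral_lebesgue_on[of "{a..b}" "\<lambda>t. ?T (f t)"]
      by (simp add: has_bochner_integral_iff)
    moreover have "((\<lambda>t. ?T (f t)) has_integral ?T (integral {a..b} f)) {a..b}"
      using has_integral_linear[OF integrable_integral[OF integrable_continuous_interval[OF f]]
          bounded_linear_lipfree_apply]
      by (simp add: o_def)
    ultimately show "?T x = ?T (integral {a..b} f)" by (rule has_integral_unique)
  qed
  then show ?thesis using bochner_integral_eq[OF x] by simp
qed

text \<open>Riemann sums over tagged divisions are linear combinations of values of
  \<open>f\<close>, hence lie in \<open>Y\<close>, and they come arbitrarily close to
  \<open>x\<close>.\<close>

lemma has_integral_in_closed_subspace:
  fixes f :: "real \<Rightarrow> 'b::real_normed_vector"
  assumes int: "(f has_integral x) {a..b}"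
    and Y: "closed Y" "subspace Y" and f: "\<And>t. t \<in> {a..b} \<Longrightarrow> f t \<in> Y"
  shows "x \<in> Y"
proof -
  have "x \<in> closure Y"
    unfolding closure_approachable
  proof safe
    fix e :: real assume "0 < e"
    from int[unfolded has_integral_real, rule_format, OF this] obtain \<gamma> where \<gamma>: "gauge \<gamma>"
      "\<And>\<D>. \<D> tagged_division_of {a..b} \<Longrightarrow> \<gamma> fine \<D> \<Longrightarrow>
        norm (sum (\<lambda>(x,k). measure lborel k *\<^sub>R f x) \<D> - x) < e"
      by (elim exE conjE) (rule that, auto)
    obtain \<D> where \<D>: "\<D> tagged_division_of {a..b}" "\<gamma> fine \<D>"
      using fine_division_exists_real[OF \<gamma>(1)] .
    have "sum (\<lambda>(x,k). measure lborel k *\<^sub>R f x) \<D> \<in> Y"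
    proof (rule subspace_sum[OF Y(2)])
      fix z assume "z \<in> \<D>"
      then show "(case z of (x, k) \<Rightarrow> measure lborel k *\<^sub>R f x) \<in> Y"
        using tag_in_interval[OF \<D>(1)] f by (cases z) (auto intro: subspace_scale[OF Y(2)])
    qed
    then show "\<exists>y\<in>Y. dist y x < e" using \<gamma>(2)[OF \<D>] unfolding dist_norm by blast
  qed
  then show ?thesis using Y(1) by simp
qed

section \<open>Integrals of periodic functions\<close>

text \<open>For \<open>0 \<le> c\<close>, splitting \<open>{0..c + p}\<close> at \<open>c\<close>
  and at \<open>p\<close> leaves the pieces over \<open>{0..c}\<close> and
  \<open>{p..c + p}\<close>, whose integrals agree by periodicity.\<close>

lemma integral_periodic_shift:
  fixes f :: "real \<Rightarrow> 'b::banach"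
  assumes cont: "continuous_on UNIV f" and per: "\<And>x. f (x + p) = f x" and p: "0 \<le> p"
  shows "integral {c..c + p} f = integral {0..p} f"
proof -
  have *: "integral {c..c + p} g = integral {0..p} g"
    if g: "continuous_on UNIV g" "\<And>x. g (x + p) = g x" and c: "0 \<le> c" for g :: "real \<Rightarrow> 'b" and c
  proof -
    have int: "g integrable_on {u..v}" for u v
      by (rule integrable_continuous_interval, rule continuous_on_subset[OF g(1)]) simp
    have "integral {0..c} g + integral {c..c + p} g = integral {0..c + p} g"
      by (rule Henstock_Kurzweil_Integration.integral_combine) (use c p int in auto)
    also have "\<dots> = integral {0..p} g + integral {p..c + p} g"
      by (rule Henstock_Kurzweil_Integration.integral_combine[symmetric]) (use c p int in auto)
    also have "integral {p..c + p} g = integral {0..c} g"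
      using integral_shift_Icc_real[of 0 c g p] g(2) by (simp add: o_def add.commute)
    finally show ?thesis by simp
  qed
  show ?thesis
  proof (cases "0 \<le> c")
    case True
    then show ?thesis using * cont per by blast
  next
    case False
    \<comment> \<open>A negative \<open>c\<close> reduces to the case already treated: the translate
      \<open>f \<circ> (+) c\<close> is shifted by the positive amount \<open>- c\<close>, which
      brings back \<open>f\<close> on \<open>{0..p}\<close>.\<close>
    have "integral {- c..- c + p} (f \<circ> (+) c) = integral {0..p} (f \<circ> (+) c)"
    proof (rule *)
      show "continuous_on UNIV (f \<circ> (+) c)"
        by (intro continuous_on_compose continuous_intros continuous_on_subset[OF cont]) auto
      show "(f \<circ> (+) c) (x + p) = (f \<circ> (+) c) x" for x
        using per[of "c + x"] by (simp add: add.assoc)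
    qed (use False in simp)
    then show ?thesis by (simp add: integral_shift_Icc_real add.commute)
  qed
qed

lemma integral_periodic_reflect:
  fixes f :: "real \<Rightarrow> 'b::banach"
  assumes cont: "continuous_on UNIV f" and per: "\<And>x. f (x + p) = f x" and p: "0 \<le> p"
  shows "integral {0..p} (\<lambda>x. f (c - x)) = integral {0..p} f"
proof -
  have "integral {0..p} (\<lambda>x. f (c - x)) = integral {- p..0} (\<lambda>x. f (c + x))"
    using Henstock_Kurzweil_Integration.integral_reflect_real[of 0 "-p" "\<lambda>x. f (c + x)"] by simp
  also have "\<dots> = integral {c - p..c - p + p} f"
    using integral_shift_Icc_real[of "-p" 0 f c] by (simp add: o_def)
  also have "\<dots> = integral {0..p} f"
    by (rule integral_periodic_shift[OF cont per p])
  finally show ?thesis .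
qed

text \<open>\<open>C\<close> and \<open>D\<close> are, up to normalization, the Fourier coefficients
  of \<open>u\<close> at frequency one. Both summands of the integrand contribute
  \<open>cos \<phi> C + sin \<phi> D\<close>, so \<open>I 0 = 2 C\<close> and
  \<open>I (pi / 2) = 2 D\<close>. The lemma is meant for the orbit map of a point.\<close>

lemma integral_first_harmonic:
  fixes u :: "real \<Rightarrow> 'b::banach"
  assumes cont: "continuous_on UNIV u" and per: "\<And>x. u (x + 2 * pi) = u x"
  defines "I \<equiv> \<lambda>\<phi>. integral {0..2 * pi} (\<lambda>\<theta>. cos \<theta> *\<^sub>R u (\<phi> - \<theta>) + sin \<theta> *\<^sub>R u (\<phi> + pi / 2 - \<theta>))"
  shows "I \<phi> = cos \<phi> *\<^sub>R I 0 + sin \<phi> *\<^sub>R I (pi / 2)"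
proof -
  define C where "C = integral {0..2 * pi} (\<lambda>\<theta>. cos \<theta> *\<^sub>R u \<theta>)"
  define D where "D = integral {0..2 * pi} (\<lambda>\<theta>. sin \<theta> *\<^sub>R u \<theta>)"
  have cont_sub: "continuous_on S (\<lambda>\<theta>. u (c - \<theta>))" for S c
    by (rule continuous_on_compose2[OF cont]) (auto intro!: continuous_intros)
  have cont': "continuous_on S u" for S
    by (rule continuous_on_subset[OF cont]) simp
  have int: "f integrable_on {0..2 * pi}" if "continuous_on {0..2 * pi} f" for f :: "real \<Rightarrow> 'b"
    by (rule integrable_continuous_interval[OF that])
  \<comment> \<open>One substitution serves both summands: the factor
    \<open>cos (\<phi> - (c - \<theta>))\<close> is \<open>cos \<theta>\<close> for
    \<open>c = \<phi>\<close> and \<open>sin \<theta>\<close> for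
    \<open>c = \<phi> + pi / 2\<close>.\<close>
  have shift: "integral {0..2 * pi} (\<lambda>\<theta>. cos (\<phi> - (c - \<theta>)) *\<^sub>R u (c - \<theta>))
    = integral {0..2 * pi} (\<lambda>\<theta>. cos (\<phi> - \<theta>) *\<^sub>R u \<theta>)" for \<phi> c
  proof (rule integral_periodic_reflect[of "\<lambda>s. cos (\<phi> - s) *\<^sub>R u s"])
    show "cos (\<phi> - (x + 2 * pi)) *\<^sub>R u (x + 2 * pi) = cos (\<phi> - x) *\<^sub>R u x" for x
      using cos_periodic[of "\<phi> - (x + 2 * pi)"] per[of x] by (simp add: algebra_simps)
  qed (auto intro!: continuous_intros cont')
  have cosint: "integral {0..2 * pi} (\<lambda>\<theta>. cos \<theta> *\<^sub>R u (\<phi> - \<theta>)) = cos \<phi> *\<^sub>R C + sin \<phi> *\<^sub>R D" for \<phi>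
  proof -
    have "integral {0..2 * pi} (\<lambda>\<theta>. cos \<theta> *\<^sub>R u (\<phi> - \<theta>))
      = integral {0..2 * pi} (\<lambda>\<theta>. cos (\<phi> - \<theta>) *\<^sub>R u \<theta>)"
      using shift[of \<phi> \<phi>] by simp
    also have "\<dots> = integral {0..2 * pi} (\<lambda>\<theta>. cos \<phi> *\<^sub>R (cos \<theta> *\<^sub>R u \<theta>) + sin \<phi> *\<^sub>R (sin \<theta> *\<^sub>R u \<theta>))"
      by (simp add: cos_diff scaleR_add_left)
    also have "\<dots> = cos \<phi> *\<^sub>R C + sin \<phi> *\<^sub>R D"
      unfolding C_def D_def
      by (subst Henstock_Kurzweil_Integration.integral_add)
        (auto intro!: int continuous_intros cont' simp del: scaleR_scaleR)
    finally show ?thesis .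
  qed
  have sinint: "integral {0..2 * pi} (\<lambda>\<theta>. sin \<theta> *\<^sub>R u (\<phi> + pi / 2 - \<theta>)) = cos \<phi> *\<^sub>R C + sin \<phi> *\<^sub>R D" for \<phi>
  proof -
    have "integral {0..2 * pi} (\<lambda>\<theta>. sin \<theta> *\<^sub>R u (\<phi> + pi / 2 - \<theta>))
      = integral {0..2 * pi} (\<lambda>\<theta>. cos (\<phi> - \<theta>) *\<^sub>R u \<theta>)"
      using shift[of \<phi> "\<phi> + pi / 2"] by (simp add: cos_diff)
    also have "\<dots> = cos \<phi> *\<^sub>R C + sin \<phi> *\<^sub>R D"
      using cosint[of \<phi>] shift[of \<phi> \<phi>] by simp
    finally show ?thesis .
  qed
  have I: "I \<phi> = 2 *\<^sub>R (cos \<phi> *\<^sub>R C + sin \<phi> *\<^sub>R D)" for \<phi>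
  proof -
    have "I \<phi> = integral {0..2 * pi} (\<lambda>\<theta>. cos \<theta> *\<^sub>R u (\<phi> - \<theta>)) +
        integral {0..2 * pi} (\<lambda>\<theta>. sin \<theta> *\<^sub>R u (\<phi> + pi / 2 - \<theta>))"
      unfolding I_def
      by (intro Henstock_Kurzweil_Integration.integral_add int continuous_on_scaleR
          continuous_on_cos continuous_on_sin continuous_on_id cont_sub)
    then show ?thesis unfolding cosint sinint scaleR_2 .
  qed
  show ?thesis unfolding I by (simp add: scaleR_add_right mult.commute)
qed

section \<open>Averaging over a circle action\<close>

context isometric_circle_action
begin

abbreviation averaging_integrand :: "'m \<Rightarrow> real \<Rightarrow> 'm lipfree"
  where "averaging_integrand m \<theta> \<equiv>
    cos \<theta> *\<^sub>R delta (act (cis (- \<theta>)) m) + sin \<theta> *\<^sub>R delta (act (\<i> * cis (- \<theta>)) m)"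

text \<open>The generator of \<open>Z_circle\<close> belonging to \<open>m\<close>, written with the
  gauge integral; \<open>Z_circle_eq\<close> justifies the change of integral.\<close>

definition average :: "'m \<Rightarrow> 'm lipfree"
  where "average m = (1 / (2 * pi)) *\<^sub>R integral {0..2 * pi} (averaging_integrand m)"

lemma continuous_on_orbit: "continuous_on S (\<lambda>\<theta>. delta (act (cis \<theta>) m))"
proof (rule continuous_on_compose2[OF lipschitz_on_continuous_on[OF lipschitz_on_delta[of UNIV]]])
  show "continuous_on S (\<lambda>\<theta>. act (cis \<theta>) m)"
    by (rule continuous_on_compose2[OF act_continuous])
      (auto simp: cis_conv_exp intro!: continuous_intros)
qed simp

text \<open>Writing the second group element as a single \<open>cis\<close> expresses the integrand
  through one orbit map, evaluated at \<open>- \<theta>\<close> and at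
  \<open>pi / 2 - \<theta>\<close>.\<close>

lemma i_cis_minus: "\<i> * cis (- \<theta>) = cis (pi / 2 - \<theta>)"
  by (simp add: complex_eq_iff cos_diff sin_diff)

lemma continuous_on_averaging_integrand: "continuous_on S (averaging_integrand m)"
  unfolding i_cis_minus
  by (intro continuous_intros continuous_on_compose2[OF continuous_on_orbit[of UNIV]]) auto

lemma integrable_averaging_integrand: "averaging_integrand m integrable_on {0..2 * pi}"
  by (rule integrable_continuous_interval[OF continuous_on_averaging_integrand])

lemma Z_circle_eq: "Z_circle act = closure (span (range average))"
  unfolding Z_circle_def average_def
  by (subst bochner_integral_eq_integral[OF continuous_on_averaging_integrand]) (rule refl)

lemma average_0: "average 0 = 0"
  by (simp add: average_def act_zero delta_0 norm_mult)

text \<open>The cosine and the sine term each contribute 1 to the constant, since the action is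
  isometric and \<open>delta\<close> is 1-Lipschitz. The factor \<open>1 / (2 * pi)\<close> cancels
  the length of the interval.\<close>

lemma lipschitz_on_average: "2-lipschitz_on UNIV average"
proof (rule lipschitz_onI)
  fix m n
  have "norm (averaging_integrand m \<theta> - averaging_integrand n \<theta>) \<le> 2 * dist m n" for \<theta>
  proof -
    have 1: "norm (c *\<^sub>R (delta (act t m) - delta (act t n))) \<le> dist m n"
      if "\<bar>c\<bar> \<le> 1" "t \<in> sphere 0 1" for c t
    proof -
      have "norm (c *\<^sub>R (delta (act t m) - delta (act t n))) \<le> 1 * dist m n"
        unfolding norm_scaleR
        by (intro mult_mono that(1) order_trans[OF norm_delta_diff_le])
          (use act_isometry[OF that(2)] in auto)
      then show ?thesis by simp
    qed
    have "averaging_integrand m \<theta> - averaging_integrand n \<theta> =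
      cos \<theta> *\<^sub>R (delta (act (cis (- \<theta>)) m) - delta (act (cis (- \<theta>)) n)) +
      sin \<theta> *\<^sub>R (delta (act (\<i> * cis (- \<theta>)) m) - delta (act (\<i> * cis (- \<theta>)) n))"
      by (simp add: algebra_simps)
    then show ?thesis
      using norm_triangle_mono[OF 1[of "cos \<theta>" "cis (- \<theta>)"] 1[of "sin \<theta>" "\<i> * cis (- \<theta>)"]]
      by (simp add: norm_mult)
  qed
  then have "norm (integral {0..2 * pi} (\<lambda>\<theta>. averaging_integrand m \<theta> - averaging_integrand n \<theta>))
    \<le> 2 * dist m n * (2 * pi - 0)"
    by (intro integral_bound) (auto intro!: continuous_on_diff continuous_on_averaging_integrand)
  then have "norm (integral {0..2 * pi} (averaging_integrand m) - integral {0..2 * pi} (averaging_integrand n))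
    \<le> 2 * dist m n * (2 * pi)"
    by (subst (asm) Henstock_Kurzweil_Integration.integral_diff)
      (simp_all add: integrable_averaging_integrand)
  then have "norm (average m - average n) \<le> 2 * dist m n"
    unfolding average_def by (simp add: divide_le_eq flip: scaleR_diff_right)
  then show "dist (average m) (average n) \<le> 2 * dist m n" by (simp only: dist_norm)
qed simp

text \<open>The orbit map of the rotated point is that of \<open>m\<close> shifted by
  \<open>\<phi>\<close>, so its average is a multiple of the first harmonic \<open>I \<phi>\<close>.
  This is what makes the extension of \<open>average\<close> vanish on the generators of
  \<open>Y_circle\<close>.\<close>

lemma average_rotate: "average (act (cis \<phi>) m) = cos \<phi> *\<^sub>R average m + sin \<phi> *\<^sub>R average (act \<i> m)"
proof -
  define u where "u \<theta> = delta (act (cis \<theta>) m)" for \<theta>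
  define I where
    "I \<phi> = integral {0..2 * pi} (\<lambda>\<theta>. cos \<theta> *\<^sub>R u (\<phi> - \<theta>) + sin \<theta> *\<^sub>R u (\<phi> + pi / 2 - \<theta>))" for \<phi>
  \<comment> \<open>Stated for every angle because it is also used at \<open>0\<close> and at
    \<open>pi / 2\<close>, where it gives the averages of \<open>m\<close> and of
    \<open>act \<i> m\<close>.\<close>
  have avg: "average (act (cis \<phi>) m) = (1 / (2 * pi)) *\<^sub>R I \<phi>" for \<phi>
  proof -
    have "act (cis a) (act (cis b) m) = act (cis (a + b)) m" for a b
      using act_mult[of "cis a" "cis b" m] by (simp add: cis_mult)
    then show ?thesis
      by (simp add: average_def I_def u_def i_cis_minus algebra_simps)
  qed
  have "I \<phi> = cos \<phi> *\<^sub>R I 0 + sin \<phi> *\<^sub>R I (pi / 2)"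
    unfolding I_def
  proof (rule integral_first_harmonic)
    show "continuous_on UNIV u" unfolding u_def by (rule continuous_on_orbit)
    show "u (x + 2 * pi) = u x" for x by (simp add: u_def cis_mult[symmetric])
  qed
  then show ?thesis
    using avg[of \<phi>] avg[of 0] avg[of "pi / 2"]
    by (simp add: act_one scaleR_add_right mult.commute)
qed

text \<open>The difference is the mean over \<open>\<theta>\<close> of the integrand minus
  \<open>delta m\<close>. All these values lie in the closed subspace \<open>Y_circle act\<close>,
  hence so does their mean.\<close>

lemma average_minus_delta_in_Y: "average m - delta m \<in> Y_circle act"
proof -
  have Y: "closed (Y_circle act)" "subspace (Y_circle act)"
    unfolding Y_circle_def by (auto intro: subspace_closure subspace_span)
  define w where "w \<theta> = delta (act (cis \<theta>) m) - cos \<theta> *\<^sub>R delta m - sin \<theta> *\<^sub>R delta (act \<i> m)" for \<theta>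
  have w: "w \<theta> \<in> Y_circle act" for \<theta>
    unfolding Y_circle_def w_def by (intro subsetD[OF closure_subset] span_base) blast
  \<comment> \<open>In the combination of the generators \<open>w\<close>, the multiples of
    \<open>delta (act \<i> m)\<close> cancel, and those of \<open>delta m\<close> add up to
    \<open>- (cos\<^sup>2 \<theta> + sin\<^sup>2 \<theta>) = - 1\<close>.\<close>
  have eq: "averaging_integrand m \<theta> - delta m = cos \<theta> *\<^sub>R w (- \<theta>) + sin \<theta> *\<^sub>R w (pi / 2 - \<theta>)" for \<theta>
  proof -
    have "(cos \<theta> * cos \<theta>) *\<^sub>R delta m + (sin \<theta> * sin \<theta>) *\<^sub>R delta m = delta m"
      by (simp flip: scaleR_add_left)
    then show ?thesis
      unfolding w_def i_cis_minus by (simp add: cos_diff sin_diff algebra_simps)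
  qed
  have "((\<lambda>\<theta>. averaging_integrand m \<theta> - delta m) has_integral
      integral {0..2 * pi} (averaging_integrand m) - (2 * pi - 0) *\<^sub>R delta m) {0..2 * pi}"
    using has_integral_diff[OF integrable_integral[OF integrable_averaging_integrand]
        has_integral_const_real[of "delta m" 0 "2 * pi"], of m] by simp
  then have "integral {0..2 * pi} (averaging_integrand m) - (2 * pi - 0) *\<^sub>R delta m \<in> Y_circle act"
    by (rule has_integral_in_closed_subspace[OF _ Y])
      (unfold eq, intro subspace_add[OF Y(2)] subspace_scale[OF Y(2)] w)
  from subspace_scale[OF Y(2) this, of "1 / (2 * pi)"] show ?thesis
    by (simp add: average_def scaleR_diff_right)
qed

end

section \<open>Kernel and range of the extended average\<close>

theorem proposition20:
  fixes act :: "complex \<Rightarrow> 'm::pointed_metric_space \<Rightarrow> 'm"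
  assumes "isometric_circle_action act"
  shows "complemented (Z_circle act) \<and> quotient_isomorphic_to (Y_circle act) (Z_circle act)"
proof -
  interpret isometric_circle_action act by fact
  obtain P where P: "bounded_linear P" and P_delta: "\<And>m. P (delta m) = average m"
    using lipfree_extension[OF lipschitz_on_average average_0] by blast
  interpret P: bounded_linear P by fact
  have Y: "closed (Y_circle act)" "subspace (Y_circle act)"
    unfolding Y_circle_def by (auto intro: subspace_closure subspace_span)
  \<comment> \<open>The kernel of \<open>P\<close> is a closed subspace, so the generators suffice;
    on them the claim is \<open>average_rotate\<close>.\<close>
  have "Y_circle act \<subseteq> {y. P y = 0}"
    unfolding Y_circle_def
  proof (intro closure_minimal span_minimal)
    show "subspace {y. P y = 0}" by (rule linear_subspace_kernel[OF P.linear_axioms])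
    show "closed {y. P y = 0}"
      by (intro closed_Collect_eq P.continuous_on continuous_intros)
  qed (auto simp: P.diff P.scaleR P_delta average_rotate)
  then have P_Y: "P y = 0" if "y \<in> Y_circle act" for y using that by blast
  have lin: "bounded_linear (\<lambda>x. P x - x)"
    by (intro bounded_linear_sub P bounded_linear_ident)
  have "{x. P x - x \<in> Y_circle act} = UNIV"
  proof (rule closed_subspace_lipfree_eq_UNIV)
    show "closed {x. P x - x \<in> Y_circle act}"
      using continuous_closed_vimage[OF Y(1), of "\<lambda>x. P x - x"]
      by (simp add: vimage_def linear_continuous_at[OF lin])
    show "subspace {x. P x - x \<in> Y_circle act}"
      using linear_subspace_vimage[OF bounded_linear.linear[OF lin] Y(2)]
      by (simp add: vimage_def)
  qed (simp add: P_delta average_minus_delta_in_Y)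
  then have P_mod_Y: "P x - x \<in> Y_circle act" for x by blast
  have "range P = Z_circle act"
  proof
    have img: "span (range average) = P ` span (range delta)"
      using linear_span_image[OF P.linear_axioms, of "range delta"] by (simp add: image_image P_delta)
    have "P ` closure (span (range delta)) \<subseteq> closure (P ` span (range delta))"
      by (rule image_closure_subset)
        (auto intro: P.continuous_on continuous_on_id subsetD[OF closure_subset])
    then show "range P \<subseteq> Z_circle act"
      unfolding Z_circle_eq img closure_span_delta .
    \<comment> \<open>Idempotence makes the range the fixed-point set of \<open>P\<close>, which is
      closed by continuity. Thus it contains not only the span of the averages but also its
      closure.\<close>
    have "x \<in> range P \<longleftrightarrow> P x = x" for x
      using P_Y[OF P_mod_Y] by (auto simp: P.diff) (metis rangeI)
    then have "range P = {x. P x = x}" by blast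
    moreover have "closed {x. P x = x}"
      by (intro closed_Collect_eq P.continuous_on continuous_intros)
    ultimately have "closed (range P)" by simp
    then show "Z_circle act \<subseteq> range P"
      unfolding Z_circle_eq img by (intro closure_minimal) auto
  qed
  then show ?thesis
    using complemented_quotient_isomorphic[OF P Y(2) P_Y P_mod_Y] by simp
qed

end
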